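(* Let $R$ be a semi-potent ring. Then the following three statements are equivalent: (1) $R$ is a $UJ^{\#}$ ring. (2) $R/J(R)$ is Boolean. (3) $R$ is a $UJ$ ring.
   Context: All rings are associative with identity. $J(R)$ is the Jacobson radical and $U(R)$ the group of units of $R$. Define $J^{\#}(R)=\{z\in R : z^n\in J(R)\text{ for some } n\ge 1\}$. A ring $R$ is called a $UJ^{\#}$ ring if $U(R)=1+J^{\#}(R)$, and a $UJ$ ring if $U(R)=1+J(R)$. A ring $R$ is semi-potent if every one-sided ideal not contained in $J(R)$ contains a nonzero idempotent. A ring is Boolean if every element is idempotent. *)

theory Defs
  imports "HOL-Algebra.Algebra"
begin

text \<open>
  In HOL-Algebra, \<^locale>\<open>ideal\<close> and \<^locale>\<open>maximalideal\<close> are two-sided. Rings need not be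
  commutative here, so one-sided ideals are introduced separately.
\<close>

locale left_ideal = additive_subgroup I R + ring R for I and R (structure) +
  assumes I_l_closed: "\<lbrakk>a \<in> I; x \<in> carrier R\<rbrakk> \<Longrightarrow> x \<otimes> a \<in> I"

locale right_ideal = additive_subgroup I R + ring R for I and R (structure) +
  assumes I_r_closed: "\<lbrakk>a \<in> I; x \<in> carrier R\<rbrakk> \<Longrightarrow> a \<otimes> x \<in> I"

locale maximal_left_ideal = left_ideal +
  assumes I_notcarr: "carrier R \<noteq> I"
    and I_maximal: "\<lbrakk>left_ideal J R; I \<subseteq> J\<rbrakk> \<Longrightarrow> J = I \<or> J = carrier R"

text \<open>
  The intersection of all maximal left ideals, taken within the carrier: in the zero ring there are
  no maximal left ideals and the radical is the whole ring.
\<close>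

definition jacobson_radical :: "('a, 'b) ring_scheme \<Rightarrow> 'a set" where
  "jacobson_radical R = {x \<in> carrier R. \<forall>M. maximal_left_ideal M R \<longrightarrow> x \<in> M}"

definition jacobson_sharp :: "('a, 'b) ring_scheme \<Rightarrow> 'a set" where
  "jacobson_sharp R =
     {z \<in> carrier R. \<exists>n::nat. n \<ge> 1 \<and> z [^]\<^bsub>R\<^esub> n \<in> jacobson_radical R}"

text \<open>
  \<^const>\<open>Units\<close> consists of the elements with a two-sided inverse, and \<^term>\<open>a_l_coset R x S\<close> is the
  translate \<open>x + S\<close> of any subset \<open>S\<close> (not necessarily a subgroup).
\<close>

definition uj_sharp_ring :: "('a, 'b) ring_scheme \<Rightarrow> bool" where
  "uj_sharp_ring R \<longleftrightarrow> ring R \<and> Units R = \<one>\<^bsub>R\<^esub> <+\<^bsub>R\<^esub> jacobson_sharp R"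

definition uj_ring :: "('a, 'b) ring_scheme \<Rightarrow> bool" where
  "uj_ring R \<longleftrightarrow> ring R \<and> Units R = \<one>\<^bsub>R\<^esub> <+\<^bsub>R\<^esub> jacobson_radical R"

definition semi_potent_ring :: "('a, 'b) ring_scheme \<Rightarrow> bool" where
  "semi_potent_ring R \<longleftrightarrow> ring R \<and>
     (\<forall>I. (left_ideal I R \<or> right_ideal I R) \<and> \<not> I \<subseteq> jacobson_radical R \<longrightarrow>
          (\<exists>e\<in>I. e \<noteq> \<zero>\<^bsub>R\<^esub> \<and> e \<otimes>\<^bsub>R\<^esub> e = e))"

locale boolean_ring = ring R for R (structure) +
  assumes idem: "x \<in> carrier R \<Longrightarrow> x \<otimes> x = x"

end

theory Submission
  imports Defs
begin

text \<open>
  The substantial implication is that a semi-potent \<open>UJ\<^sup>#\<close> ring is Boolean modulo its radical \<open>J\<close>.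
  Units lift modulo \<open>J\<close>, so in \<open>S = R/J\<close> every unit is unipotent, and every nonzero principal left
  ideal of \<open>S\<close> contains a nonzero idempotent. If \<open>a\<^sup>2 = 0\<close> with \<open>a \<noteq> 0\<close>, an idempotent \<open>ra \<noteq> 0\<close>
  yields a system of 2 by 2 matrix units in \<open>S\<close>; but 2 by 2 matrix rings contain a unit \<open>u\<close> with
  \<open>u - 1\<close> invertible, which contradicts unipotence. Hence \<open>S\<close> is reduced, its idempotents are
  central and its only unit is 1. If \<open>x \<noteq> x\<^sup>2\<close>, take a nonzero idempotent \<open>e = r(x - x\<^sup>2)\<close>: then
  \<open>x\<close> is invertible in the corner \<open>eS\<close>, so \<open>ex + 1 - e\<close> is a unit, so \<open>ex = e\<close> and \<open>e = 0\<close>.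
\<close>

subsection \<open>Rings with unipotent units\<close>

context ring
begin

lemma add_minus_cancel:
  assumes "a \<in> carrier R" "z \<in> carrier R"
  shows "a \<oplus> z \<ominus> a = z" "a \<oplus> (z \<ominus> a) = z"
  using assms by (simp_all add: a_minus_def a_comm[of a] a_assoc r_neg l_neg)

lemma idempotent_complement:
  assumes "e \<in> carrier R" "e \<otimes> e = e"
  shows "e \<otimes> (\<one> \<ominus> e) = \<zero>" "(\<one> \<ominus> e) \<otimes> e = \<zero>"
    "(\<one> \<ominus> e) \<otimes> (\<one> \<ominus> e) = \<one> \<ominus> e"
  using assms by (simp_all add: a_minus_def l_distr r_distr l_minus r_minus r_neg)

text \<open>The geometric sum \<open>s = 1 + z + ... + z^(n-1)\<close> is a factor with
  \<open>(1 - z) s = s (1 - z) = 1 - z^n\<close>. If \<open>1 - z^n\<close> is invertible, this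
  gives \<open>1 - z\<close> a right and a left inverse.\<close>

lemma minus_pow_Unit:
  assumes z: "z \<in> carrier R" and u: "\<one> \<ominus> z [^] (n::nat) \<in> Units R"
  shows "\<one> \<ominus> z \<in> Units R"
proof -
  have "\<exists>s\<in>carrier R. (\<one> \<ominus> z) \<otimes> s = \<one> \<ominus> z [^] n \<and> s \<otimes> (\<one> \<ominus> z) = \<one> \<ominus> z [^] n"
  proof (induction n)
    case 0
    \<comment> \<open>The empty sum is \<open>\<zero>\<close>, and
      \<open>1 - z^0 = 0\<close>.\<close>
    show ?case using z by (intro bexI[of _ \<zero>]) (auto simp: a_minus_def r_neg)
  next
    case (Suc n)
    then obtain s where s: "s \<in> carrier R" "(\<one> \<ominus> z) \<otimes> s = \<one> \<ominus> z [^] n"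
      "s \<otimes> (\<one> \<ominus> z) = \<one> \<ominus> z [^] n" by blast
    \<comment> \<open>Horner step: \<open>1 + s z\<close> is the geometric sum with one more
      term.\<close>
    have "(\<one> \<ominus> z) \<otimes> (\<one> \<oplus> s \<otimes> z) = (\<one> \<ominus> z) \<oplus> ((\<one> \<ominus> z) \<otimes> s) \<otimes> z"
      using z s(1) by (simp add: r_distr m_assoc)
    also have "\<dots> = \<one> \<ominus> z [^] Suc n"
      unfolding s(2) using z by (simp add: l_distr a_minus_def l_minus a_assoc r_neg1)
    finally have 1: "(\<one> \<ominus> z) \<otimes> (\<one> \<oplus> s \<otimes> z) = \<one> \<ominus> z [^] Suc n" .
    have zc: "z \<otimes> (\<one> \<ominus> z) = (\<one> \<ominus> z) \<otimes> z"
      using z by (simp add: l_distr r_distr a_minus_def l_minus r_minus)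
    have "(\<one> \<oplus> s \<otimes> z) \<otimes> (\<one> \<ominus> z) = (\<one> \<ominus> z) \<oplus> s \<otimes> (z \<otimes> (\<one> \<ominus> z))"
      using z s(1) by (simp add: l_distr m_assoc)
    also have "\<dots> = (\<one> \<ominus> z) \<oplus> (s \<otimes> (\<one> \<ominus> z)) \<otimes> z"
      unfolding zc using z s(1) by (simp add: m_assoc)
    also have "\<dots> = \<one> \<ominus> z [^] Suc n"
      unfolding s(3) using z by (simp add: l_distr a_minus_def l_minus a_assoc r_neg1)
    finally show ?case using 1 z s(1) by (intro bexI[of _ "\<one> \<oplus> s \<otimes> z"]) auto
  qed
  then obtain s where s: "s \<in> carrier R" "(\<one> \<ominus> z) \<otimes> s = \<one> \<ominus> z [^] n"
    "s \<otimes> (\<one> \<ominus> z) = \<one> \<ominus> z [^] n" by blast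
  define v where "v = inv (\<one> \<ominus> z [^] n)"
  have v: "v \<in> carrier R" "(\<one> \<ominus> z [^] n) \<otimes> v = \<one>" "v \<otimes> (\<one> \<ominus> z [^] n) = \<one>"
    using u by (auto simp: v_def)
  have r: "(\<one> \<ominus> z) \<otimes> (s \<otimes> v) = \<one>"
    using s(1,2) v z by (simp add: m_assoc[symmetric])
  have l: "(v \<otimes> s) \<otimes> (\<one> \<ominus> z) = \<one>"
    using s(1,3) v z by (simp add: m_assoc)
  have "s \<otimes> v = v \<otimes> s"
    using inv_unique[OF l r] s(1) v z by simp
  then show ?thesis using l r s(1) v(1) z unfolding Units_def by auto
qed

text \<open>Since \<open>z = z^2 y\<close>, one has \<open>z^(n+1) = z^(n+2) y\<close>, so the
  vanishing of a power of \<open>z\<close> descends one exponent at a time down to \<open>z\<close>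
  itself.\<close>

lemma strongly_regular_nilpotent:
  assumes z: "z \<in> carrier R" "y \<in> carrier R" "z \<otimes> z \<otimes> y = z"
    and n: "z [^] Suc n = \<zero>"
  shows "z = \<zero>"
  using n
proof (induction n)
  case 0
  then show ?case using z by simp
next
  case (Suc n)
  have "z [^] Suc n = z [^] n \<otimes> (z \<otimes> z \<otimes> y)" using z by simp
  also have "\<dots> = z [^] Suc (Suc n) \<otimes> y" using z(1,2) by (simp add: m_assoc)
  also have "\<dots> = \<zero>" using Suc.prems z by simp
  finally show ?case by (rule Suc.IH)
qed

text \<open>
  Such \<open>p\<close> and \<open>q\<close> behave like the off-diagonal matrix units of a corner ring of 2 by 2 matrices;
  there \<open>(1 - p)(1 - q)\<close> and \<open>(1 - p)(1 - q) - 1\<close> are both invertible.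
\<close>

lemma matrix_units_zero:
  assumes unip: "\<And>u. u \<in> Units R \<Longrightarrow> \<exists>n. (u \<ominus> \<one>) [^] Suc n = \<zero>"
    and p: "p \<in> carrier R" and q: "q \<in> carrier R"
    and pp: "p \<otimes> p = \<zero>" and qq: "q \<otimes> q = \<zero>"
    and pqp: "p \<otimes> q \<otimes> p = p" and qpq: "q \<otimes> p \<otimes> q = q"
  shows "p \<otimes> q = \<zero>"
proof -
  have sq: "\<one> \<ominus> x \<in> Units R" if "x \<in> carrier R" "x \<otimes> x = \<zero>" for x
  proof (rule minus_pow_Unit[of x 2])
    have "x [^] (2::nat) = x \<otimes> x" using that by (simp add: numeral_2_eq_2)
    then show "\<one> \<ominus> x [^] (2::nat) \<in> Units R" using that by (simp add: a_minus_def)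
  qed (use that in simp)
  have u: "(\<one> \<ominus> p) \<otimes> (\<one> \<ominus> q) \<in> Units R"
    using sq p q pp qq by blast
  \<comment> \<open>With \<open>p = e12\<close> and \<open>q = e21\<close>, the products
    \<open>p q\<close> and \<open>q p\<close> are \<open>e11\<close> and \<open>e22\<close>. So
    \<open>g\<close> is the identity of the corner, and \<open>z\<close>, which is the unit
    \<open>(1 - p)(1 - q)\<close> minus 1, is the matrix with rows (1, -1) and (-1, 0).\<close>
  define z where "z = p \<otimes> q \<ominus> p \<ominus> q"
  define g where "g = p \<otimes> q \<oplus> q \<otimes> p"
  have cl: "z \<in> carrier R" "g \<in> carrier R" using p q by (auto simp: z_def g_def)
  have rel: "p \<otimes> (q \<otimes> p) = p" "q \<otimes> (p \<otimes> q) = q"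
    using pqp qpq p q by (auto simp: m_assoc)
  have rel': "p \<otimes> (p \<otimes> x) = \<zero>" "q \<otimes> (q \<otimes> x) = \<zero>" 
      "p \<otimes> (q \<otimes> (p \<otimes> x)) = p \<otimes> x" "q \<otimes> (p \<otimes> (q \<otimes> x)) = q \<otimes> x"
    if "x \<in> carrier R" for x
    using that pp qq pqp qpq p q by (auto simp: m_assoc[symmetric])
  \<comment> \<open>These rules rewrite every word in \<open>p\<close> and \<open>q\<close> to an
    alternating word of length at most 2 or to \<open>\<zero>\<close>.\<close>
  note rs = z_def g_def a_minus_def l_distr r_distr l_minus r_minus minus_add m_assoc 
    a_ac r_neg r_neg1 r_neg2 l_neg rel rel' pp qq
  have uz: "(\<one> \<ominus> p) \<otimes> (\<one> \<ominus> q) \<ominus> \<one> = z"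
  proof -
    have "(\<one> \<ominus> p) \<otimes> (\<one> \<ominus> q) = \<one> \<oplus> z" using p q by (simp add: rs)
    then show ?thesis using cl(1) by (simp add: add_minus_cancel)
  qed
  have zg: "z \<otimes> g = z" using p q by (simp add: rs)
  have zz: "z \<otimes> z = z \<oplus> g" using p q by (simp add: rs)
  \<comment> \<open>Cayley-Hamilton \<open>z^2 = z + g\<close> makes \<open>z - g\<close> the
    inverse of \<open>z\<close> in the corner, so \<open>z\<close> cannot be a nonzero
    nilpotent.\<close>
  have "z \<otimes> (z \<ominus> g) = g"
  proof -
    have "z \<otimes> (z \<ominus> g) = z \<oplus> g \<ominus> z" using cl by (simp add: a_minus_def r_distr r_minus zg zz)
    then show ?thesis using cl by (simp add: add_minus_cancel)
  qed
  then have "z \<otimes> z \<otimes> (z \<ominus> g) = z" using cl by (simp add: m_assoc zg)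
  moreover obtain n where "z [^] Suc n = \<zero>" using unip[OF u] unfolding uz by blast
  ultimately have "z = \<zero>" using strongly_regular_nilpotent[of z "z \<ominus> g"] cl by auto
  then have "\<ominus> (p \<otimes> z) = \<zero>" using p by simp
  moreover have "\<ominus> (p \<otimes> z) = p \<otimes> q" using p q by (simp add: rs)
  ultimately show ?thesis by simp
qed

text \<open>The two hypotheses \<open>unip\<close> and \<open>semipot\<close> are what the quotient
  by the radical will satisfy; stating them for an arbitrary ring keeps cosets out of the
  argument.\<close>

lemma reducedI:
  assumes unip: "\<And>u. u \<in> Units R \<Longrightarrow> \<exists>n. (u \<ominus> \<one>) [^] Suc n = \<zero>"
    and semipot: "\<And>x. x \<in> carrier R \<Longrightarrow> x \<noteq> \<zero> \<Longrightarrow>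
       \<exists>r\<in>carrier R. r \<otimes> x \<noteq> \<zero> \<and> (r \<otimes> x) \<otimes> (r \<otimes> x) = r \<otimes> x"
    and a: "a \<in> carrier R" "a \<otimes> a = \<zero>"
  shows "a = \<zero>"
proof (rule ccontr)
  assume "a \<noteq> \<zero>"
  then obtain r where r: "r \<in> carrier R" "r \<otimes> a \<noteq> \<zero>"
    "(r \<otimes> a) \<otimes> (r \<otimes> a) = r \<otimes> a" using semipot a by blast
  define e where "e = r \<otimes> a"
  have e: "e \<in> carrier R" "e \<otimes> e = e" "e \<noteq> \<zero>" using r a by (auto simp: e_def)
  have ea: "e \<otimes> a = \<zero>" using r a by (simp add: e_def m_assoc)
  have ea': "e \<otimes> (a \<otimes> x) = \<zero>" if "x \<in> carrier R" for x
    using that ea e a by (simp add: m_assoc[symmetric])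
  have ee': "e \<otimes> (e \<otimes> x) = e \<otimes> x" if "x \<in> carrier R" for x
    using that e by (simp add: m_assoc[symmetric])
  have ra': "r \<otimes> (a \<otimes> x) = e \<otimes> x" if "x \<in> carrier R" for x
    using that r a by (simp add: m_assoc e_def)
  have ra: "r \<otimes> a = e" by (simp add: e_def)
  \<comment> \<open>The off-diagonal units come from \<open>e = r a\<close>. As
    \<open>e a = 0\<close>, the element \<open>q\<close> is killed by \<open>e\<close> on the left;
    the factor \<open>1 - e\<close> makes \<open>p\<close> killed by \<open>e\<close> on the right.
    This yields \<open>p p = q q = 0\<close>, while \<open>p q = e\<close>.\<close>
  define q where "q = a \<otimes> e"
  define p where "p = e \<otimes> r \<otimes> (\<one> \<ominus> e)"
  have cl: "p \<in> carrier R" "q \<in> carrier R" using e r a by (auto simp: p_def q_def)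
  note rs = p_def q_def m_assoc a_minus_def l_distr r_distr l_minus r_minus
    ea ea' ee' ra ra' e(2)
  have ep: "e \<otimes> p = p" using e(1) r(1) a(1) by (simp add: rs)
  have qe: "q \<otimes> e = q" using e(1) r(1) a(1) by (simp add: rs)
  have pq: "p \<otimes> q = e" using e(1) r(1) a(1) by (simp add: rs)
  have pe: "p \<otimes> e = \<zero>" using e(1) r(1) a(1) by (simp add: rs r_neg)
  have eq: "e \<otimes> q = \<zero>" using e(1) r(1) a(1) by (simp add: rs)
  have "p \<otimes> p = (p \<otimes> e) \<otimes> p" using ep cl e by (simp add: m_assoc)
  then have pp: "p \<otimes> p = \<zero>" using pe cl by simp
  have "q \<otimes> q = q \<otimes> (e \<otimes> q)" using qe cl e by (simp add: m_assoc[symmetric])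
  then have qq: "q \<otimes> q = \<zero>" using eq cl by simp
  have "p \<otimes> q \<otimes> p = p" using pq ep by simp
  moreover have "q \<otimes> p \<otimes> q = q" using pq qe cl by (simp add: m_assoc)
  ultimately have "p \<otimes> q = \<zero>" by (intro matrix_units_zero[OF unip cl pp qq])
  then show False using pq e by simp
qed

text \<open>The Peirce components \<open>e x (1 - e)\<close> and \<open>(1 - e) x e\<close> have
  square zero, hence vanish, so \<open>e x = e x e = x e\<close>.\<close>

lemma reduced_idempotent_central:
  assumes red: "\<And>a. a \<in> carrier R \<Longrightarrow> a \<otimes> a = \<zero> \<Longrightarrow> a = \<zero>"
    and e: "e \<in> carrier R" "e \<otimes> e = e" and x: "x \<in> carrier R"
  shows "e \<otimes> x = x \<otimes> e"
proof -
  let ?c = "\<one> \<ominus> e"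
  note c = idempotent_complement[OF e]
  have "e \<otimes> x \<otimes> ?c = \<zero>"
  proof (rule red)
    have "(e \<otimes> x \<otimes> ?c) \<otimes> (e \<otimes> x \<otimes> ?c) = (e \<otimes> x) \<otimes> ((?c \<otimes> e) \<otimes> (x \<otimes> ?c))"
      using e(1) x by (simp add: m_assoc)
    then show "(e \<otimes> x \<otimes> ?c) \<otimes> (e \<otimes> x \<otimes> ?c) = \<zero>" using c e x by simp
  qed (use e x in simp)
  then have "e \<otimes> x \<ominus> e \<otimes> x \<otimes> e = \<zero>" using e x by (simp add: a_minus_def r_distr r_minus)
  then have 1: "e \<otimes> x = e \<otimes> x \<otimes> e" using e x by simp
  have "?c \<otimes> x \<otimes> e = \<zero>"
  proof (rule red)
    have "(?c \<otimes> x \<otimes> e) \<otimes> (?c \<otimes> x \<otimes> e) = (?c \<otimes> x) \<otimes> ((e \<otimes> ?c) \<otimes> (x \<otimes> e))"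
      using e(1) x by (simp add: m_assoc)
    then show "(?c \<otimes> x \<otimes> e) \<otimes> (?c \<otimes> x \<otimes> e) = \<zero>" using c e x by simp
  qed (use e x in simp)
  then have "x \<otimes> e \<ominus> e \<otimes> x \<otimes> e = \<zero>" using e x by (simp add: a_minus_def l_distr l_minus)
  then have 2: "x \<otimes> e = e \<otimes> x \<otimes> e" using e x by simp
  show ?thesis using 1 2 by simp
qed

lemma boolean_ringI_unipotent_units:
  assumes unip: "\<And>u. u \<in> Units R \<Longrightarrow> \<exists>n. (u \<ominus> \<one>) [^] Suc n = \<zero>"
    and semipot: "\<And>x. x \<in> carrier R \<Longrightarrow> x \<noteq> \<zero> \<Longrightarrow>
       \<exists>r\<in>carrier R. r \<otimes> x \<noteq> \<zero> \<and> (r \<otimes> x) \<otimes> (r \<otimes> x) = r \<otimes> x"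
  shows "boolean_ring R"
proof -
  have red: "a = \<zero>" if "a \<in> carrier R" "a \<otimes> a = \<zero>" for a
    by (rule reducedI[OF unip semipot]) (use that in auto)
  have nilp: "z = \<zero>" if "z \<in> carrier R" "z [^] Suc n = \<zero>" for z n
    using that(2)
  proof (induction n)
    case 0
    then show ?case using that by simp
  next
    case (Suc n)
    \<comment> \<open>The square of \<open>z^(n+1)\<close> already contains the factor
      \<open>z^(n+2) = 0\<close>, so reducedness lowers the exponent by one.\<close>
    have "z [^] Suc n \<otimes> z [^] Suc n = z [^] (Suc (Suc n) + n)"
      using that by (simp only: nat_pow_mult) simp
    also have "\<dots> = z [^] Suc (Suc n) \<otimes> z [^] n"
      using that by (simp only: nat_pow_mult)
    also have "\<dots> = \<zero>" using that by (simp only: Suc.prems) simp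
    finally have "z [^] Suc n = \<zero>" by (rule red[rotated]) (use that(1) in simp)
    then show ?case by (rule Suc.IH)
  qed
  have units: "u = \<one>" if u: "u \<in> Units R" for u
    using nilp[of "u \<ominus> \<one>"] unip[OF u] u by auto
  have "x \<otimes> x = x" if x: "x \<in> carrier R" for x
  proof (rule ccontr)
    assume "x \<otimes> x \<noteq> x"
    then have "x \<ominus> x \<otimes> x \<noteq> \<zero>" using x by auto
    then obtain r where r: "r \<in> carrier R" and ne: "r \<otimes> (x \<ominus> x \<otimes> x) \<noteq> \<zero>"
      and id: "(r \<otimes> (x \<ominus> x \<otimes> x)) \<otimes> (r \<otimes> (x \<ominus> x \<otimes> x)) = r \<otimes> (x \<ominus> x \<otimes> x)"
      using semipot[of "x \<ominus> x \<otimes> x"] x by auto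
    define e where "e = r \<otimes> (x \<ominus> x \<otimes> x)"
    have e: "e \<in> carrier R" "e \<otimes> e = e" "e \<noteq> \<zero>" using r x ne id by (auto simp: e_def)
    note central = reduced_idempotent_central[OF red]
    have ec: "e \<otimes> y = y \<otimes> e" if "y \<in> carrier R" for y by (rule central) (use that e in auto)
    \<comment> \<open>As \<open>e = r (1 - x) x\<close>, the element \<open>r (1 - x)\<close> is a
      left inverse of \<open>x\<close> relative to \<open>e\<close>; multiplying by \<open>e\<close>
      moves it into the corner.\<close>
    define s where "s = e \<otimes> (r \<otimes> (\<one> \<ominus> x))"
    have s: "s \<in> carrier R" using e r x by (simp add: s_def)
    have es: "e \<otimes> s = s" using e r x by (simp add: s_def m_assoc[symmetric])
    have se: "s \<otimes> e = s" using ec[OF s] es by simp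
    have "r \<otimes> ((\<one> \<ominus> x) \<otimes> x) = e"
      using r x by (simp add: e_def l_distr a_minus_def l_minus)
    then have "s \<otimes> x = e \<otimes> e" using e(1) r x by (simp add: s_def m_assoc)
    then have sx: "s \<otimes> x = e" using e by simp
    \<comment> \<open>The left inverse \<open>s\<close> is also a right inverse: \<open>h\<close> is
      idempotent because \<open>s x = e\<close>, hence central, and so
      \<open>e = s x s x = s h x = h s x = x s e = x s\<close>.\<close>
    define h where "h = x \<otimes> s"
    have h: "h \<in> carrier R" using x s by (simp add: h_def)
    have "h \<otimes> h = x \<otimes> ((s \<otimes> x) \<otimes> s)" using x s by (simp add: h_def m_assoc)
    then have hh: "h \<otimes> h = h" by (simp add: sx es h_def)
    have hc: "h \<otimes> s = s \<otimes> h" by (rule central) (use h hh s in auto)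
    have "e = (s \<otimes> x) \<otimes> (s \<otimes> x)" using sx e by simp
    also have "\<dots> = (s \<otimes> h) \<otimes> x" using s x by (simp add: h_def m_assoc)
    also have "\<dots> = h \<otimes> (s \<otimes> x)" using hc s h x by (simp add: m_assoc[symmetric])
    also have "\<dots> = x \<otimes> (s \<otimes> e)" using s x e by (simp add: sx h_def m_assoc)
    finally have xs: "x \<otimes> s = e" using se by simp
    define c where "c = \<one> \<ominus> e"
    have c: "c \<in> carrier R" "e \<otimes> c = \<zero>" "c \<otimes> e = \<zero>" "c \<otimes> c = c" "e \<oplus> c = \<one>"
      using idempotent_complement[OF e(1,2)] add_minus_cancel(2)[OF e(1) one_closed] e
      by (simp_all add: c_def)
    \<comment> \<open>Adding \<open>c = 1 - e\<close> extends the corner unit \<open>x e\<close> and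
      its inverse \<open>s\<close> to a unit \<open>v\<close> of the whole ring with inverse
      \<open>w\<close>.\<close>
    define v where "v = x \<otimes> e \<oplus> c"
    define w where "w = s \<oplus> c"
    have vw: "v \<in> carrier R" "w \<in> carrier R" using x e s c by (auto simp: v_def w_def)
    have sc: "s \<otimes> c = \<zero>" "c \<otimes> s = \<zero>"
    proof -
      have "s \<otimes> c = s \<otimes> (e \<otimes> c)" "c \<otimes> s = (c \<otimes> e) \<otimes> s"
        using se es s e(1) c(1) by (simp add: m_assoc[symmetric], simp add: m_assoc)
      then show "s \<otimes> c = \<zero>" "c \<otimes> s = \<zero>" using c s by simp_all
    qed
    have cx: "c \<otimes> (x \<otimes> e) = \<zero>"
      unfolding ec[OF x, symmetric] using c e(1) x by (simp add: m_assoc[symmetric])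
    have "v \<otimes> w = x \<otimes> (e \<otimes> s) \<oplus> x \<otimes> (e \<otimes> c) \<oplus> (c \<otimes> s \<oplus> c \<otimes> c)"
      using x s e(1) c(1) by (simp add: v_def w_def l_distr r_distr m_assoc a_ac)
    also have "\<dots> = \<one>" unfolding sc es xs c using x c(1) e(1) by (simp add: c(5))
    finally have "v \<otimes> w = \<one>" .
    moreover have "w \<otimes> v = \<one>"
    proof -
      have "w \<otimes> v = (s \<otimes> x) \<otimes> e \<oplus> s \<otimes> c \<oplus> (c \<otimes> (x \<otimes> e) \<oplus> c \<otimes> c)"
        using x s e(1) c(1) by (simp add: v_def w_def l_distr r_distr m_assoc a_ac)
      also have "\<dots> = \<one>" unfolding sc sx cx c e(2) using x c(1) e(1) by (simp add: c(5))
      finally show ?thesis .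
    qed
    ultimately have "v \<in> Units R" using vw unfolding Units_def by auto
    then have v1: "v = \<one>" by (rule units)
    have "x \<otimes> e = v \<otimes> e" using x e(1,2) c(1,3) by (simp add: v_def l_distr m_assoc)
    then have xe1: "x \<otimes> e = e" using v1 e by simp
    \<comment> \<open>On \<open>e\<close> the element \<open>x\<close> acts as 1, so
      \<open>x - x^2\<close> annihilates it.\<close>
    have "e = r \<otimes> (x \<ominus> x \<otimes> x) \<otimes> e" using e by (simp add: e_def)
    also have "\<dots> = r \<otimes> (x \<otimes> e \<ominus> x \<otimes> (x \<otimes> e))"
      using r x e(1) by (simp add: m_assoc a_minus_def l_distr l_minus)
    also have "\<dots> = \<zero>" using r e(1) by (simp add: xe1 a_minus_def r_neg)
    finally show False using e by simp
  qed
  then show ?thesis by unfold_locales auto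
qed

subsection \<open>The Jacobson radical\<close>

lemma left_idealI:
  assumes I: "I \<subseteq> carrier R" "\<zero> \<in> I" and add: "\<And>a b. a \<in> I \<Longrightarrow> b \<in> I \<Longrightarrow> a \<oplus> b \<in> I"
    and mult: "\<And>a x. a \<in> I \<Longrightarrow> x \<in> carrier R \<Longrightarrow> x \<otimes> a \<in> I"
  shows "left_ideal I R"
proof -
  have "\<ominus> a \<in> I" if "a \<in> I" for a
    using mult[OF that, of "\<ominus> \<one>"] that I by (auto simp: l_minus)
  then have "subgroup I (add_monoid R)"
    using I add by (intro add.subgroupI) (auto simp: a_inv_def)
  then have "additive_subgroup I R" by (rule additive_subgroupI)
  then show ?thesis
    using ring_axioms mult by (simp add: left_ideal_def left_ideal_axioms_def)
qed

lemma left_idealD: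
  assumes "left_ideal I R"
  shows "I \<subseteq> carrier R" "\<zero> \<in> I" "a \<in> I \<Longrightarrow> b \<in> I \<Longrightarrow> a \<oplus> b \<in> I"
    "a \<in> I \<Longrightarrow> x \<in> carrier R \<Longrightarrow> x \<otimes> a \<in> I" "a \<in> I \<Longrightarrow> \<ominus> a \<in> I"
proof -
  interpret left_ideal I R by fact
  show "I \<subseteq> carrier R" "\<zero> \<in> I" "a \<in> I \<Longrightarrow> b \<in> I \<Longrightarrow> a \<oplus> b \<in> I"
    "a \<in> I \<Longrightarrow> x \<in> carrier R \<Longrightarrow> x \<otimes> a \<in> I"  "a \<in> I \<Longrightarrow> \<ominus> a \<in> I"
    using a_subset I_l_closed by auto
qed

lemma left_ideal_eq_carrier:
  assumes "left_ideal I R" "\<one> \<in> I"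
  shows "I = carrier R"
  using left_idealD(1)[OF assms(1)] left_idealD(4)[OF assms] r_one by force

lemma left_ideal_Union_chain:
  assumes "C \<noteq> {}" "\<And>I. I \<in> C \<Longrightarrow> left_ideal I R"
    and chain: "\<And>I K. I \<in> C \<Longrightarrow> K \<in> C \<Longrightarrow> I \<subseteq> K \<or> K \<subseteq> I"
  shows "left_ideal (\<Union>C) R"
proof (rule left_idealI)
  show "\<Union>C \<subseteq> carrier R" using assms(2) left_idealD(1) by blast
  show "\<zero> \<in> \<Union>C" using assms(1,2) left_idealD(2) by blast
  show "a \<oplus> b \<in> \<Union>C" if ab: "a \<in> \<Union>C" "b \<in> \<Union>C" for a b
  proof -
    obtain I where "I \<in> C" "a \<in> I" "b \<in> I" using ab chain by blast
    then show ?thesis using assms(2) left_idealD(3) by blast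
  qed
  show "x \<otimes> a \<in> \<Union>C" if "a \<in> \<Union>C" "x \<in> carrier R" for a x
    using that assms(2) left_idealD(4) by blast
qed

text \<open>Zorn's lemma on the left ideals that contain \<open>I\<close> and avoid
  \<open>\<one>\<close>. For left ideals, avoiding \<open>\<one>\<close> is the same as being
  proper, and it survives unions of chains.\<close>

lemma proper_left_ideal_in_maximal:
  assumes I: "left_ideal I R" "\<one> \<notin> I"
  shows "\<exists>M. maximal_left_ideal M R \<and> I \<subseteq> M"
proof -
  define \<A> where "\<A> = {K. left_ideal K R \<and> I \<subseteq> K \<and> \<one> \<notin> K}"
  have "\<exists>M\<in>\<A>. \<forall>K\<in>\<A>. M \<subseteq> K \<longrightarrow> K = M"
  proof (rule subset_Zorn_nonempty)
    have "I \<in> \<A>" using I by (simp add: \<A>_def)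
    then show "\<A> \<noteq> {}" by blast
    fix C assume C: "C \<noteq> {}" "subset.chain \<A> C"
    have CA: "left_ideal K R" "I \<subseteq> K" "\<one> \<notin> K" if "K \<in> C" for K
      using C(2) that by (auto simp: subset_chain_def \<A>_def)
    have "left_ideal (\<Union>C) R"
    proof (rule left_ideal_Union_chain[OF C(1) CA(1)])
      show "K \<subseteq> L \<or> L \<subseteq> K" if "K \<in> C" "L \<in> C" for K L
        using C(2) that by (simp add: subset_chain_def)
    qed
    moreover have "I \<subseteq> \<Union>C"
    proof -
      obtain K where "K \<in> C" using C(1) by blast
      then show ?thesis using CA(2)[of K] by blast
    qed
    moreover have "\<one> \<notin> \<Union>C" using CA(3) by (simp only: Union_iff) metis
    ultimately show "\<Union>C \<in> \<A>" by (simp add: \<A>_def)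
  qed
  then obtain M where M: "M \<in> \<A>" and max: "\<forall>K\<in>\<A>. M \<subseteq> K \<longrightarrow> K = M" by (rule bexE)
  have Ml: "left_ideal M R" "I \<subseteq> M" "\<one> \<notin> M" using M by (simp_all add: \<A>_def)
  have "carrier R \<noteq> M" using Ml(3) one_closed by metis
  moreover have "K = M \<or> K = carrier R" if K: "left_ideal K R" "M \<subseteq> K" for K
  proof (cases "\<one> \<in> K")
    case True
    then show ?thesis using left_ideal_eq_carrier[OF K(1)] by simp
  next
    case False
    then have "K \<in> \<A>" using K Ml(2) by (simp add: \<A>_def)
    then show ?thesis using max K(2) by simp
  qed
  ultimately have "maximal_left_ideal M R"
    by (intro maximal_left_ideal.intro maximal_left_ideal_axioms.intro Ml(1))
  then show ?thesis using Ml(2) by blast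
qed

lemma principal_left_ideal:
  assumes a: "a \<in> carrier R"
  shows "left_ideal {r \<otimes> a | r. r \<in> carrier R} R"
proof -
  define I where "I = {r \<otimes> a | r. r \<in> carrier R}"
  have mem: "r \<otimes> a \<in> I" if "r \<in> carrier R" for r
    using that unfolding I_def by blast
  have "left_ideal I R"
  proof (rule left_idealI)
    show "I \<subseteq> carrier R" using a by (auto simp: I_def)
    show "\<zero> \<in> I" using mem[OF zero_closed] a by simp
    show "x \<oplus> y \<in> I" if xy: "x \<in> I" "y \<in> I" for x y
    proof -
      obtain r s where rs: "r \<in> carrier R" "s \<in> carrier R" "x = r \<otimes> a" "y = s \<otimes> a"
        using xy unfolding I_def by blast
      then have "x \<oplus> y = (r \<oplus> s) \<otimes> a" using a by (simp add: l_distr)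
      then show ?thesis using mem[of "r \<oplus> s"] rs(1,2) by simp
    qed
    show "y \<otimes> x \<in> I" if x: "x \<in> I" and y: "y \<in> carrier R" for x y
    proof -
      obtain r where r: "r \<in> carrier R" "x = r \<otimes> a" using x unfolding I_def by blast
      then have "y \<otimes> x = (y \<otimes> r) \<otimes> a" using y a by (simp add: m_assoc)
      then show ?thesis using mem[of "y \<otimes> r"] r(1) y by simp
    qed
  qed
  then show ?thesis by (simp add: I_def)
qed

lemma self_in_principal_left_ideal:
  assumes "a \<in> carrier R"
  shows "a \<in> {r \<otimes> a | r. r \<in> carrier R}"
  using assms by (intro CollectI exI[of _ \<one>]) simp

lemma maximal_left_idealD:
  assumes "maximal_left_ideal M R"
  shows "left_ideal M R" "\<one> \<notin> M"
    "left_ideal K R \<Longrightarrow> M \<subseteq> K \<Longrightarrow> K = M \<or> K = carrier R"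
proof -
  interpret maximal_left_ideal M R by fact
  show l: "left_ideal M R" by (rule left_ideal_axioms)
  show "\<one> \<notin> M" using left_ideal_eq_carrier[OF l] I_notcarr by blast
  show "K = M \<or> K = carrier R" if "left_ideal K R" "M \<subseteq> K"
    using that by (rule I_maximal)
qed

section \<open>The radical: invertibility of \<open>1 + x\<close> and two-sidedness\<close>

lemma jacobson_radical_left_ideal: "left_ideal (jacobson_radical R) R"
proof -
  note D = left_idealD[OF maximal_left_idealD(1)]
  show ?thesis
    by (rule left_idealI) (use D(2-4) in \<open>auto simp: jacobson_radical_def\<close>)
qed

lemmas jacobson_radicalD = left_idealD[OF jacobson_radical_left_ideal]

text \<open>Otherwise the left ideal generated by \<open>1 + x\<close> lies in a maximal one, which
  also contains \<open>x\<close> and therefore \<open>(1 + x) - x = 1\<close>.\<close>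

lemma jacobson_radical_left_inverse:
  assumes x: "x \<in> jacobson_radical R"
  shows "\<exists>v\<in>carrier R. v \<otimes> (\<one> \<oplus> x) = \<one>"
proof (rule ccontr)
  assume neg: "\<not> ?thesis"
  have xc: "x \<in> carrier R" using x jacobson_radicalD(1) by blast
  let ?I = "{r \<otimes> (\<one> \<oplus> x) | r. r \<in> carrier R}"
  have "left_ideal ?I R" using xc by (intro principal_left_ideal) simp
  moreover have "\<one> \<notin> ?I"
  proof
    assume "\<one> \<in> ?I"
    then obtain r where "r \<in> carrier R" "r \<otimes> (\<one> \<oplus> x) = \<one>" by auto
    then show False using neg by blast
  qed
  ultimately obtain M where M: "maximal_left_ideal M R" "?I \<subseteq> M"
    using proper_left_ideal_in_maximal by blast
  note Ml = maximal_left_idealD(1)[OF M(1)]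
  have "x \<in> M" using x M(1) by (auto simp: jacobson_radical_def)
  moreover have "\<one> \<oplus> x \<in> ?I" using xc by (intro self_in_principal_left_ideal) simp
  ultimately have "(\<one> \<oplus> x) \<oplus> \<ominus> x \<in> M" using left_idealD(3,5)[OF Ml] M(2) by blast
  then have "\<one> \<in> M" using xc by (simp add: a_assoc r_neg)
  then show False using maximal_left_idealD(2)[OF M(1)] by blast
qed

text \<open>A left inverse \<open>v\<close> of \<open>1 + x\<close> equals \<open>1 - v x\<close>,
  again 1 plus a radical element, so \<open>v\<close> has a left inverse too. Having inverses on
  both sides, \<open>v\<close> is a unit, and so is \<open>1 + x\<close>.\<close>

lemma jacobson_radical_one_plus_Unit:
  assumes x: "x \<in> jacobson_radical R"
  shows "\<one> \<oplus> x \<in> Units R"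
proof -
  have xc: "x \<in> carrier R" using x jacobson_radicalD(1) by blast
  obtain v where v: "v \<in> carrier R" "v \<otimes> (\<one> \<oplus> x) = \<one>"
    using jacobson_radical_left_inverse[OF x] by blast
  have "v = v \<otimes> (\<one> \<oplus> x) \<oplus> (\<ominus> v) \<otimes> x"
    using v(1) xc by (simp add: r_distr l_minus a_assoc r_neg)
  then have ve: "v = \<one> \<oplus> (\<ominus> v) \<otimes> x" using v(2) by simp
  have "(\<ominus> v) \<otimes> x \<in> jacobson_radical R" using v x by (intro jacobson_radicalD(4)) auto
  then obtain w where w: "w \<in> carrier R" "w \<otimes> v = \<one>"
    using jacobson_radical_left_inverse ve by metis
  have "\<one> \<oplus> x = w" using inv_unique[OF w(2) v(2)] w v xc by simp
  then show ?thesis using w v xc unfolding Units_def by auto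
qed

text \<open>Jacobson's lemma: if \<open>c\<close> inverts \<open>1 - b a\<close>, then
  \<open>1 + a c b\<close> inverts \<open>1 - a b\<close>. It serves to prove that the radical is
  closed under right multiplication.\<close>

lemma one_minus_Unit_swap:
  assumes a: "a \<in> carrier R" and b: "b \<in> carrier R" and u: "\<one> \<ominus> b \<otimes> a \<in> Units R"
  shows "\<one> \<ominus> a \<otimes> b \<in> Units R"
proof -
  define c where "c = inv (\<one> \<ominus> b \<otimes> a)"
  have c: "c \<in> carrier R" "(\<one> \<ominus> b \<otimes> a) \<otimes> c = \<one>" "c \<otimes> (\<one> \<ominus> b \<otimes> a) = \<one>"
    using u by (auto simp: c_def)
  define d where "d = \<one> \<oplus> a \<otimes> (c \<otimes> b)"
  have d: "d \<in> carrier R" using a b c(1) by (simp add: d_def)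
  have "(\<one> \<ominus> a \<otimes> b) \<otimes> d = (\<one> \<ominus> a \<otimes> b) \<oplus> a \<otimes> (((\<one> \<ominus> b \<otimes> a) \<otimes> c) \<otimes> b)"
    using a b c(1) by (simp add: d_def a_minus_def l_distr r_distr l_minus r_minus minus_add m_assoc a_ac)
  also have "\<dots> = \<one>" unfolding c(2) using a b by (simp add: a_minus_def a_assoc l_neg)
  finally have 1: "(\<one> \<ominus> a \<otimes> b) \<otimes> d = \<one>" .
  have "d \<otimes> (\<one> \<ominus> a \<otimes> b) = (\<one> \<ominus> a \<otimes> b) \<oplus> a \<otimes> ((c \<otimes> (\<one> \<ominus> b \<otimes> a)) \<otimes> b)"
    using a b c(1) by (simp add: d_def a_minus_def l_distr r_distr l_minus r_minus minus_add m_assoc a_ac)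
  also have "\<dots> = \<one>" unfolding c(3) using a b by (simp add: a_minus_def a_assoc l_neg)
  finally have 2: "d \<otimes> (\<one> \<ominus> a \<otimes> b) = \<one>" .
  show ?thesis using 1 2 d a b unfolding Units_def by auto
qed

text \<open>If a maximal left ideal \<open>M\<close> misses \<open>x r\<close>, then
  \<open>M + R x r\<close> is the whole ring, so \<open>1 = m + s x r\<close> with \<open>m\<close>
  in \<open>M\<close>. Swapping factors shows that \<open>m = 1 - (s x) r\<close> is a unit, so
  \<open>M\<close> is not proper.\<close>

lemma jacobson_radical_r_closed:
  assumes x: "x \<in> jacobson_radical R" and r: "r \<in> carrier R"
  shows "x \<otimes> r \<in> jacobson_radical R"
proof (rule ccontr)
  have xc: "x \<in> carrier R" using x jacobson_radicalD(1) by blast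
  assume "x \<otimes> r \<notin> jacobson_radical R"
  then obtain M where M: "maximal_left_ideal M R" and nM: "x \<otimes> r \<notin> M"
    using xc r by (auto simp: jacobson_radical_def)
  have Ml: "left_ideal M R" by (rule maximal_left_idealD(1)[OF M])
  note MD = left_idealD[OF Ml]
  define K where "K = {m \<oplus> s \<otimes> (x \<otimes> r) | m s. m \<in> M \<and> s \<in> carrier R}"
  have mem: "m \<oplus> s \<otimes> (x \<otimes> r) \<in> K" if "m \<in> M" "s \<in> carrier R" for m s
    using that unfolding K_def by blast
  have rep: "\<exists>m s. m \<in> M \<and> m \<in> carrier R \<and> s \<in> carrier R \<and> a = m \<oplus> s \<otimes> (x \<otimes> r)"
    if "a \<in> K" for a
    using that MD(1) unfolding K_def by blast
  have "left_ideal K R"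
  proof (rule left_idealI)
    show "K \<subseteq> carrier R" using rep xc r by fastforce
    show "\<zero> \<in> K" using mem[OF MD(2) zero_closed] xc r by simp
    show "a \<oplus> b \<in> K" if ab: "a \<in> K" "b \<in> K" for a b
    proof -
      obtain m s m' s' where ms: "m \<in> M" "m \<in> carrier R" "s \<in> carrier R" 
        "m' \<in> M" "m' \<in> carrier R" "s' \<in> carrier R"
        and a: "a = m \<oplus> s \<otimes> (x \<otimes> r)" and b: "b = m' \<oplus> s' \<otimes> (x \<otimes> r)"
        using rep[OF ab(1)] rep[OF ab(2)] by metis
      have "a \<oplus> b = (m \<oplus> m') \<oplus> (s \<oplus> s') \<otimes> (x \<otimes> r)"
        unfolding a b using ms xc r by (simp add: l_distr a_ac)
      then show ?thesis using mem[of "m \<oplus> m'" "s \<oplus> s'"] ms MD(3) by simp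
    qed
    show "b \<otimes> a \<in> K" if ab: "a \<in> K" "b \<in> carrier R" for a b
    proof -
      obtain m s where ms: "m \<in> M" "m \<in> carrier R" "s \<in> carrier R"
        and a: "a = m \<oplus> s \<otimes> (x \<otimes> r)"
        using rep[OF ab(1)] by metis
      have "b \<otimes> a = b \<otimes> m \<oplus> (b \<otimes> s) \<otimes> (x \<otimes> r)"
        unfolding a using ms xc r ab(2) by (simp add: r_distr m_assoc)
      then show ?thesis using mem[of "b \<otimes> m" "b \<otimes> s"] ms ab(2) MD(4) by simp
    qed
  qed
  moreover have "M \<subseteq> K"
  proof
    fix m assume m: "m \<in> M"
    then have "m \<in> carrier R" using MD(1) by blast
    then show "m \<in> K" using mem[OF m zero_closed] xc r by simp
  qed
  moreover have "x \<otimes> r \<in> K" using mem[OF MD(2) one_closed] xc r by simp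
  ultimately have "K = carrier R"
    using maximal_left_idealD(3)[OF M] nM by metis
  then obtain m s where m: "\<one> = m \<oplus> s \<otimes> (x \<otimes> r)" "m \<in> M" "s \<in> carrier R"
    and mc: "m \<in> carrier R"
    using rep[of \<one>] one_closed by metis
  \<comment> \<open>In the order \<open>r s x\<close> the radical element stands on the right, so
    left closure applies; the swap then returns to \<open>s x r\<close>.\<close>
  have "\<ominus> (r \<otimes> (s \<otimes> x)) \<in> jacobson_radical R"
    using x r m by (intro jacobson_radicalD(4,5))
  then have "\<one> \<ominus> r \<otimes> (s \<otimes> x) \<in> Units R"
    unfolding a_minus_def by (rule jacobson_radical_one_plus_Unit)
  then have "\<one> \<ominus> (s \<otimes> x) \<otimes> r \<in> Units R" using one_minus_Unit_swap[of "s \<otimes> x" r] r m xc by simp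
  moreover have "\<one> \<ominus> (s \<otimes> x) \<otimes> r = m"
    using mc xc r m(3) by (subst m(1)) (simp add: a_minus_def a_assoc m_assoc r_neg)
  ultimately have u: "m \<in> Units R" by simp
  have "inv m \<otimes> m \<in> M" by (rule MD(4)) (use m(2) u in auto)
  then have "\<one> \<in> M" using u by simp
  then show False using maximal_left_idealD(2)[OF M] by blast
qed

lemma jacobson_radical_ideal: "ideal (jacobson_radical R) R"
proof -
  interpret J: left_ideal "jacobson_radical R" R by (rule jacobson_radical_left_ideal)
  show ?thesis
    by (intro idealI ring_axioms J.a_subgroup jacobson_radicalD(4) jacobson_radical_r_closed)
qed

text \<open>The unit \<open>1 - e\<close> annihilates \<open>e\<close>.\<close>

lemma jacobson_radical_idempotent:
  assumes e: "e \<in> jacobson_radical R" "e \<otimes> e = e"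
  shows "e = \<zero>"
proof -
  have ec: "e \<in> carrier R" using e jacobson_radicalD(1) by blast
  have "\<one> \<oplus> \<ominus> e \<in> Units R" by (intro jacobson_radical_one_plus_Unit jacobson_radicalD(5) e)
  moreover from this have "(\<one> \<oplus> \<ominus> e) \<otimes> e = (\<one> \<oplus> \<ominus> e) \<otimes> \<zero>"
    using e ec by (simp add: l_distr l_minus r_neg)
  ultimately show ?thesis using ec by (subst (asm) Units_l_cancel) auto
qed

section \<open>The set \<open>jacobson_sharp R\<close> and translates of the form
  \<open>1 + K\<close>\<close>

lemma jacobson_sharp_uminus:
  assumes "z \<in> jacobson_sharp R"
  shows "\<ominus> z \<in> jacobson_sharp R"
proof -
  obtain n where n: "z \<in> carrier R" "n \<ge> 1" "z [^] (n::nat) \<in> jacobson_radical R"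
    using assms by (auto simp: jacobson_sharp_def)
  have "(\<ominus> z) [^] k = z [^] k \<or> (\<ominus> z) [^] k = \<ominus> (z [^] k)" for k :: nat
    by (induction k) (use n(1) in \<open>auto simp: l_minus r_minus\<close>)
  then have "(\<ominus> z) [^] n \<in> jacobson_radical R" using n jacobson_radicalD(5) by metis
  then show ?thesis using n by (auto simp: jacobson_sharp_def)
qed

text \<open>Some power of \<open>-z\<close> lies in the radical, so 1 minus that power is a unit;
  the geometric sum passes this on to \<open>1 - (-z)\<close>.\<close>

lemma one_plus_jacobson_sharp_Unit:
  assumes "z \<in> jacobson_sharp R"
  shows "\<one> \<oplus> z \<in> Units R"
proof -
  obtain n where n: "\<ominus> z \<in> carrier R" "(\<ominus> z) [^] (n::nat) \<in> jacobson_radical R"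
    using jacobson_sharp_uminus[OF assms] by (auto simp: jacobson_sharp_def)
  have z: "z \<in> carrier R" using assms by (simp add: jacobson_sharp_def)
  have "\<one> \<ominus> (\<ominus> z) [^] n \<in> Units R"
    unfolding a_minus_def using n by (intro jacobson_radical_one_plus_Unit jacobson_radicalD(5))
  then have "\<one> \<ominus> (\<ominus> z) \<in> Units R" by (rule minus_pow_Unit[OF n(1)])
  then show ?thesis using z by (simp add: a_minus_def)
qed

lemma jacobson_radical_subset_sharp: "jacobson_radical R \<subseteq> jacobson_sharp R"
  using jacobson_radicalD(1) by (auto simp: jacobson_sharp_def intro!: exI[of _ "1::nat"])

text \<open>Common form of the two ring classes, with \<open>K\<close> the radical or
  \<open>jacobson_sharp R\<close>: the inclusion of \<open>1 + K\<close> in the units is automatic,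
  so only the converse carries information.\<close>

lemma Units_eq_translate_iff:
  assumes K: "\<And>z. z \<in> K \<Longrightarrow> z \<in> carrier R \<and> \<one> \<oplus> z \<in> Units R"
  shows "Units R = \<one> <+ K \<longleftrightarrow> (\<forall>u\<in>Units R. u \<ominus> \<one> \<in> K)"
proof -
  have "\<one> <+ K \<subseteq> Units R" unfolding a_l_coset_def' using K by blast
  moreover have "u \<in> \<one> <+ K \<longleftrightarrow> u \<ominus> \<one> \<in> K" if "u \<in> Units R" for u
  proof
    assume "u \<in> \<one> <+ K"
    then obtain z where "z \<in> K" "u = \<one> \<oplus> z" by (auto simp: a_l_coset_def')
    then show "u \<ominus> \<one> \<in> K" using K by (simp add: add_minus_cancel)
  next
    have "u = \<one> \<oplus> (u \<ominus> \<one>)" using Units_closed[OF that] by (simp add: add_minus_cancel)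
    moreover assume "u \<ominus> \<one> \<in> K"
    ultimately show "u \<in> \<one> <+ K" unfolding a_l_coset_def' by blast
  qed
  ultimately show ?thesis by blast
qed

lemma uj_sharp_ring_iff:
  "uj_sharp_ring R \<longleftrightarrow> (\<forall>u\<in>Units R. u \<ominus> \<one> \<in> jacobson_sharp R)"
proof -
  have "Units R = \<one> <+ jacobson_sharp R \<longleftrightarrow> (\<forall>u\<in>Units R. u \<ominus> \<one> \<in> jacobson_sharp R)"
    using one_plus_jacobson_sharp_Unit
    by (intro Units_eq_translate_iff) (auto simp: jacobson_sharp_def)
  then show ?thesis using ring_axioms by (simp add: uj_sharp_ring_def)
qed

lemma uj_ring_iff: "uj_ring R \<longleftrightarrow> (\<forall>u\<in>Units R. u \<ominus> \<one> \<in> jacobson_radical R)"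
proof -
  have "Units R = \<one> <+ jacobson_radical R \<longleftrightarrow> (\<forall>u\<in>Units R. u \<ominus> \<one> \<in> jacobson_radical R)"
    using jacobson_radicalD(1) jacobson_radical_one_plus_Unit by (intro Units_eq_translate_iff) blast
  then show ?thesis using ring_axioms by (simp add: uj_ring_def)
qed

subsection \<open>The quotient by the radical\<close>

context
  fixes J assumes J: "J = jacobson_radical R"
begin

interpretation ideal J R
  unfolding J by (rule jacobson_radical_ideal)

interpretation Q: ring "R Quot J"
  by (rule quotient_is_ring)

interpretation h: ring_hom_ring R "R Quot J" "(+>) J"
  by (rule rcos_ring_hom_ring)

lemma radical_quotient_cases:
  assumes "A \<in> carrier (R Quot J)"
  obtains x where "x \<in> carrier R" "A = J +> x"
  using assms unfolding FactRing_simps by force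

lemma radical_coset_eq_iff:
  assumes "x \<in> carrier R" "y \<in> carrier R"
  shows "J +> x = J +> y \<longleftrightarrow> x \<ominus> y \<in> J"
  using quotient_eq_iff_same_a_r_cos[OF ideal_axioms assms] by (rule sym)

lemma radical_coset_eq_zero_iff:
  assumes "x \<in> carrier R"
  shows "J +> x = \<zero>\<^bsub>R Quot J\<^esub> \<longleftrightarrow> x \<in> J"
proof -
  have 0: "\<zero>\<^bsub>R Quot J\<^esub> = J" by (simp only: FactRing_def ring.simps)
  show ?thesis
    unfolding 0
  proof
    assume "J +> x = J"
    then show "x \<in> J" using a_rcos_self[OF assms] by (rule subst)
  qed (rule a_rcos_const)
qed

lemma radical_quotient_boolean_iff:
  "boolean_ring (R Quot J) \<longleftrightarrow> (\<forall>x\<in>carrier R. x \<otimes> x \<ominus> x \<in> J)"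
proof -
  have "boolean_ring (R Quot J) \<longleftrightarrow> (\<forall>A\<in>carrier (R Quot J). A \<otimes>\<^bsub>R Quot J\<^esub> A = A)"
    using Q.ring_axioms by (auto simp: boolean_ring_def boolean_ring_axioms_def)
  also have "\<dots> \<longleftrightarrow> (\<forall>x\<in>carrier R. (J +> x) \<otimes>\<^bsub>R Quot J\<^esub> (J +> x) = J +> x)"
    by (metis h.hom_closed radical_quotient_cases)
  also have "\<dots> \<longleftrightarrow> (\<forall>x\<in>carrier R. x \<otimes> x \<ominus> x \<in> J)"
    by (intro ball_cong refl) (simp add: h.hom_mult[symmetric] radical_coset_eq_iff del: h.hom_mult)
  finally show ?thesis .
qed

text \<open>If \<open>y\<close> represents the inverse coset, then \<open>x y\<close> and
  \<open>y x\<close> lie in \<open>1 + J\<close> and are units, which gives \<open>x\<close> a right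
  and a left inverse.\<close>

lemma Unit_if_radical_coset_Unit:
  assumes x: "x \<in> carrier R" and u: "J +> x \<in> Units (R Quot J)"
  shows "x \<in> Units R"
proof -
  obtain B where B: "B \<in> carrier (R Quot J)" "B \<otimes>\<^bsub>R Quot J\<^esub> (J +> x) = \<one>\<^bsub>R Quot J\<^esub>"
    "(J +> x) \<otimes>\<^bsub>R Quot J\<^esub> B = \<one>\<^bsub>R Quot J\<^esub>"
    using u by (auto simp: Units_def)
  obtain y where y: "y \<in> carrier R" "B = J +> y" using B(1) by (rule radical_quotient_cases)
  have unit: "z \<in> Units R" if z: "z \<in> carrier R" "J +> z = J +> \<one>" for z
  proof -
    have "\<one> \<oplus> (z \<ominus> \<one>) \<in> Units R"
      using z radical_coset_eq_iff[OF z(1) one_closed] jacobson_radical_one_plus_Unit J by simp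
    then show ?thesis using z by (simp add: add_minus_cancel)
  qed
  have "J +> (y \<otimes> x) = J +> \<one>" "J +> (x \<otimes> y) = J +> \<one>"
    using B(2,3) x y by simp_all
  then have "y \<otimes> x \<in> Units R" "x \<otimes> y \<in> Units R" using unit x y by simp_all
  then have l: "(inv (y \<otimes> x) \<otimes> y) \<otimes> x = \<one>" and r: "x \<otimes> (y \<otimes> inv (x \<otimes> y)) = \<one>"
    and c: "inv (y \<otimes> x) \<otimes> y \<in> carrier R" "y \<otimes> inv (x \<otimes> y) \<in> carrier R"
    using x y(1) by (simp_all add: m_assoc, simp add: m_assoc[symmetric])
  have "inv (y \<otimes> x) \<otimes> y = y \<otimes> inv (x \<otimes> y)" by (rule inv_unique[OF l r x c])
  then show ?thesis using l r c x unfolding Units_def by auto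
qed

text \<open>For a unit \<open>u\<close>, multiplying \<open>u^2 - u\<close> in \<open>J\<close> by
  the inverse of \<open>u\<close> leaves \<open>u - 1\<close> in \<open>J\<close>.\<close>

lemma boolean_radical_quotient_imp_uj:
  assumes "boolean_ring (R Quot J)"
  shows "uj_ring R"
  unfolding uj_ring_iff
proof
  fix u assume u: "u \<in> Units R"
  then have "u \<otimes> u \<ominus> u \<in> J" using assms radical_quotient_boolean_iff by blast
  then have "inv u \<otimes> (u \<otimes> u \<ominus> u) \<in> J" using u by (intro I_l_closed) auto
  moreover have "inv u \<otimes> (u \<otimes> u \<ominus> u) = u \<ominus> \<one>"
    using u Units_closed[OF u] by (simp add: a_minus_def r_distr r_minus m_assoc[symmetric])
  ultimately show "u \<ominus> \<one> \<in> jacobson_radical R" using J by simp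
qed

text \<open>Both hypotheses of \<open>boolean_ringI_unipotent_units\<close> pass to the quotient:
  units lift, and \<open>u - 1\<close> in \<open>jacobson_sharp R\<close> becomes nilpotent;
  idempotents found in principal left ideals of \<open>R\<close> map to idempotents.\<close>

lemma uj_sharp_imp_boolean_radical_quotient:
  assumes semipot: "semi_potent_ring R" and uj: "uj_sharp_ring R"
  shows "boolean_ring (R Quot J)"
proof (rule Q.boolean_ringI_unipotent_units)
  fix U assume U: "U \<in> Units (R Quot J)"
  obtain u where u: "u \<in> carrier R" "U = J +> u"
    using Q.Units_closed[OF U] by (rule radical_quotient_cases)
  then have "u \<in> Units R" using U Unit_if_radical_coset_Unit by blast
  then obtain n where n: "n \<ge> 1" "(u \<ominus> \<one>) [^] (n::nat) \<in> J"
    using uj J unfolding uj_sharp_ring_iff by (auto simp: jacobson_sharp_def)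
  then have "J +> ((u \<ominus> \<one>) [^] n) = \<zero>\<^bsub>R Quot J\<^esub>"
    using u by (simp add: radical_coset_eq_zero_iff)
  moreover have "J +> ((u \<ominus> \<one>) [^] n) = (U \<ominus>\<^bsub>R Quot J\<^esub> \<one>\<^bsub>R Quot J\<^esub>) [^]\<^bsub>R Quot J\<^esub> n"
    using u by (simp add: h.hom_nat_pow a_minus_def)
  \<comment> \<open>The bound \<open>n \<ge> 1\<close> matches the exponent \<open>Suc n\<close> in
    the notion of nilpotency used for quotient units.\<close>
  moreover obtain m where "n = Suc m" using n(1) by (cases n) auto
  ultimately show "\<exists>n. (U \<ominus>\<^bsub>R Quot J\<^esub> \<one>\<^bsub>R Quot J\<^esub>) [^]\<^bsub>R Quot J\<^esub> Suc n = \<zero>\<^bsub>R Quot J\<^esub>"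
    by metis
next
  fix A assume A: "A \<in> carrier (R Quot J)" "A \<noteq> \<zero>\<^bsub>R Quot J\<^esub>"
  obtain x where x: "x \<in> carrier R" "A = J +> x" using A(1) by (rule radical_quotient_cases)
  let ?I = "{r \<otimes> x | r. r \<in> carrier R}"
  have "x \<notin> J" using A x radical_coset_eq_zero_iff by blast
  moreover have "x \<in> ?I" using x(1) by (rule self_in_principal_left_ideal)
  ultimately have "\<not> ?I \<subseteq> jacobson_radical R" using J by blast
  then obtain e where e: "e \<in> ?I" "e \<noteq> \<zero>" "e \<otimes> e = e"
    using semipot principal_left_ideal[OF x(1)] unfolding semi_potent_ring_def by blast
  then obtain r where r: "r \<in> carrier R" "e = r \<otimes> x" by blast
  have ec: "e \<in> carrier R" using r x by simp
  \<comment> \<open>The radical contains no nonzero idempotent, so \<open>e\<close> stays nonzero in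
    the quotient.\<close>
  have "e \<notin> J" using jacobson_radical_idempotent e J by blast
  then have "J +> e \<noteq> \<zero>\<^bsub>R Quot J\<^esub>" using radical_coset_eq_zero_iff ec by blast
  moreover have "(J +> e) \<otimes>\<^bsub>R Quot J\<^esub> (J +> e) = J +> e"
    using h.hom_mult[OF ec ec] e by simp
  moreover have "J +> e = (J +> r) \<otimes>\<^bsub>R Quot J\<^esub> A" using r x by simp
  ultimately show "\<exists>r\<in>carrier (R Quot J). r \<otimes>\<^bsub>R Quot J\<^esub> A \<noteq> \<zero>\<^bsub>R Quot J\<^esub> \<and>
      (r \<otimes>\<^bsub>R Quot J\<^esub> A) \<otimes>\<^bsub>R Quot J\<^esub> (r \<otimes>\<^bsub>R Quot J\<^esub> A) = r \<otimes>\<^bsub>R Quot J\<^esub> A"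
    using h.hom_closed[OF r(1)] by metis
qed

end

lemma uj_ring_imp_uj_sharp_ring: "uj_ring R \<Longrightarrow> uj_sharp_ring R"
  unfolding uj_ring_iff uj_sharp_ring_iff using jacobson_radical_subset_sharp by blast

end

section \<open>The equivalence, as a cycle of three implications\<close>

theorem theorem3p1:
  fixes R :: "('a, 'b) ring_scheme"
  assumes "semi_potent_ring R"
  shows "(uj_sharp_ring R \<longleftrightarrow> boolean_ring (R Quot (jacobson_radical R)))
       \<and> (boolean_ring (R Quot (jacobson_radical R)) \<longleftrightarrow> uj_ring R)"
proof -
  interpret ring R using assms by (simp add: semi_potent_ring_def)
  let ?Q = "R Quot (jacobson_radical R)"
  have 1: "uj_sharp_ring R \<Longrightarrow> boolean_ring ?Q"
    by (rule uj_sharp_imp_boolean_radical_quotient[OF refl assms])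
  have 2: "boolean_ring ?Q \<Longrightarrow> uj_ring R"
    by (rule boolean_radical_quotient_imp_uj[OF refl])
  have 3: "uj_ring R \<Longrightarrow> uj_sharp_ring R"
    by (rule uj_ring_imp_uj_sharp_ring)
  show ?thesis using 1 2 3 by iprover
qed

end
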